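(* Let $g:\mathbb C\to\mathbb C$ be the map defined in the context and assume $\nu^2\lambda>2L$. Let $V\subset\mathbb C$ be a connected set with positive two-dimensional Lebesgue measure. Then there is $n\in\mathbb N$ such that $g^n(V)$ intersects the real axis.
   Context: Let $L\ge1$ and let $\mathfrak h=(\mathfrak h_1,\mathfrak h_2,\mathfrak h_3)$ be a sense-preserving $L$-bi-Lipschitz map (i.e. $|a-b|/L\le|\mathfrak h(a)-\mathfrak h(b)|\le L|a-b|$) of $Q=[-1,1]^2$ onto the closed upper unit hemisphere $\{x\in\mathbb R^3:|x|=1,x_3\ge0\}$, with $\partial Q$ mapped onto the equator, satisfying $\mathfrak h_1(t,t)=\mathfrak h_2(t,t)$ and $\mathfrak h_1(t,-t)=-\mathfrak h_2(t,-t)$ for $t\in[-1,1]$. Let $\lambda\ge1$, $\nu>0$. For $y\in[-\sqrt2,\sqrt2]$ put $a(y)=\mathfrak h_3(y/\sqrt2,y/\sqrt2)$ and $b(y)=\sqrt2\,\mathfrak h_1(y/\sqrt2,y/\sqrt2)$ (so $a^2+b^2=1$). Define $g:\mathbb C\to\mathbb C$ as follows: for $z=x+iy$ with $y\in[(4k-1)\sqrt2,(4k+1)\sqrt2]$, $k\in\mathbb Z$, let $g(z)=\nu e^{\lambda x}\big(a(y-4k\sqrt2)+i\,b(y-4k\sqrt2)\big)$; for $y\in[(4k+1)\sqrt2,(4k+3)\sqrt2]$ let $g(z)=g(\bar z+2\sqrt2 i)$. (This is the conjugate of the Zorich map $\mathcal Z_\nu$ restricted to the invariant plane $x_1=x_2$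 via $(x_1,x_1,x_3)\mapsto(x_3+i\sqrt2x_1)/\lambda$.) *)

theory Defs
  imports "HOL-Complex_Analysis.Complex_Analysis"
begin

text \<open>The square Q = [-1,1]^2, the closed upper unit hemisphere and the equator in R^3.
  We use real \<times> real and real \<times> real \<times> real; their norms are Euclidean.\<close>

definition sqQ :: "(real \<times> real) set" where
  "sqQ = {-1..1} \<times> {-1..1}"

definition upper_hemisphere :: "(real \<times> real \<times> real) set" where
  "upper_hemisphere = {x. norm x = 1 \<and> snd (snd x) \<ge> 0}"

definition equator :: "(real \<times> real \<times> real) set" where
  "equator = {x. norm x = 1 \<and> snd (snd x) = 0}"

definition hc1 :: "(real \<times> real \<Rightarrow> real \<times> real \<times> real) \<Rightarrow> real \<Rightarrow> real \<Rightarrow> real" where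
  "hc1 h s t = fst (h (s, t))"
definition hc2 :: "(real \<times> real \<Rightarrow> real \<times> real \<times> real) \<Rightarrow> real \<Rightarrow> real \<Rightarrow> real" where
  "hc2 h s t = fst (snd (h (s, t)))"
definition hc3 :: "(real \<times> real \<Rightarrow> real \<times> real \<times> real) \<Rightarrow> real \<Rightarrow> real \<Rightarrow> real" where
  "hc3 h s t = snd (snd (h (s, t)))"

definition bi_lipschitz_on :: "real \<Rightarrow> ('a::metric_space) set \<Rightarrow> ('a \<Rightarrow> 'b::metric_space) \<Rightarrow> bool" where
  "bi_lipschitz_on L S f \<longleftrightarrow>
     (\<forall>a\<in>S. \<forall>b\<in>S. dist a b / L \<le> dist (f a) (f b) \<and> dist (f a) (f b) \<le> L * dist a b)"

definition boundary_loop_Q :: "real \<Rightarrow> real \<times> real" where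
  "boundary_loop_Q =
     linepath (1, -1) (1, 1) +++ (linepath (1, 1) (-1, 1) +++
       (linepath (-1, 1) (-1, -1) +++ linepath (-1, -1) (1, -1)))"

definition proj12 :: "real \<times> real \<times> real \<Rightarrow> complex" where
  "proj12 x = Complex (fst x) (fst (snd x))"

text \<open>A homeomorphism h of Q onto the upper hemisphere is sense-preserving (hemisphere oriented
  by the outward normal) iff the planar homeomorphism proj12 \<circ> h of Q onto the closed unit disc
  is orientation preserving, i.e. the image of the positively oriented boundary of Q winds
  once positively around the image of an interior point (here the centre (0,0)).\<close>
definition sense_preserving_hemi :: "(real \<times> real \<Rightarrow> real \<times> real \<times> real) \<Rightarrow> bool" where
  "sense_preserving_hemi h \<longleftrightarrow>
     winding_number (proj12 \<circ> h \<circ> boundary_loop_Q) (proj12 (h (0, 0))) = 1"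

definition za :: "(real \<times> real \<Rightarrow> real \<times> real \<times> real) \<Rightarrow> real \<Rightarrow> real" where
  "za h y = hc3 h (y / sqrt 2) (y / sqrt 2)"
definition zb :: "(real \<times> real \<Rightarrow> real \<times> real \<times> real) \<Rightarrow> real \<Rightarrow> real" where
  "zb h y = sqrt 2 * hc1 h (y / sqrt 2) (y / sqrt 2)"

text \<open>The map g. For y in [(4k-1)sqrt2,(4k+1)sqrt2] : g(z) = nu e^(lambda x)(a(y-4k sqrt2) + i b(y-4k sqrt2));
  for y in [(4k+1)sqrt2,(4k+3)sqrt2] : g(z) = g(conj z + 2 sqrt2 i), where conj z + 2 sqrt2 i has
  imaginary part 2 sqrt2 - y in [(4(-k)-1)sqrt2,(4(-k)+1)sqrt2]. The index k is chosen as
  floor((y/sqrt2+1)/4); at the common boundary lines both clauses agree.\<close>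
definition zorich_g :: "(real \<times> real \<Rightarrow> real \<times> real \<times> real) \<Rightarrow> real \<Rightarrow> real \<Rightarrow> complex \<Rightarrow> complex" where
  "zorich_g h lam nu z =
     (let x = Re z; y = Im z; k = real_of_int \<lfloor>(y / sqrt 2 + 1) / 4\<rfloor>;
          G = (\<lambda>x' y'. complex_of_real (nu * exp (lam * x')) * Complex (za h y') (zb h y'))
      in if y \<le> (4 * k + 1) * sqrt 2 then G x (y - 4 * k * sqrt 2)
         else G x (2 * sqrt 2 - y - 4 * (- k) * sqrt 2))"

end

theory Submission
  imports Defs
begin

text \<open>
  Write g(x + iy) = nu e^(lam x) phi(y') with phi = a + ib, where y' is y folded into
  [-sqrt 2, sqrt 2]. The lines Im z = 2 sqrt 2 m are mapped into the real axis, so if no iterate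
  meets the real axis, every g^n(V) lies in a strip of height 2 sqrt 2 between consecutive
  lines. On such a strip g is at most two-to-one, and since phi expands by at least 1/L, it
  multiplies area by at least nu^2 lam / (2 L) > 1 where Re z >= 0; as a >= 0, this covers every
  image under g. Hence the areas of the iterates of a compact subset of V of positive measure
  grow geometrically. On the other hand a set in {Re z >= 0} which, together with its image, lies
  in strips has bounded area: two points of a half strip with the same real part x and images in
  the same strip have imaginary parts differing by O(e^(-lam x / 2)), which is integrable.
\<close>

section \<open>Area in the complex plane: slices and differentiable images\<close>

lemma borel_measurable_Complex:
  "(\<lambda>(x, y). Complex x y) \<in> borel_measurable borel"
  by (rule borel_measurable_continuous_onI)
     (auto simp: Complex_eq case_prod_unfold intro!: continuous_intros)

lemma borel_measurable_Complex_vec2: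
  "(\<lambda>v::real^2. Complex (v$1) (v$2)) \<in> borel_measurable borel"
  by (rule borel_measurable_continuous_onI) (auto simp: Complex_eq intro!: continuous_intros)

text \<open>Boxes determine \<open>lborel\<close>, and the preimage of a box is a box with the same
  sides. The identification brings Tonelli's theorem for products to the plane.\<close>

lemma lborel_eq_distr_Complex:
  "(lborel :: complex measure) = distr (lborel :: (real \<times> real) measure) borel (\<lambda>(x, y). Complex x y)"
proof (rule lborel_eqI)
  fix l u :: complex
  assume le: "\<And>b. b \<in> Basis \<Longrightarrow> l \<bullet> b \<le> u \<bullet> b"
  have "(\<lambda>(x, y). Complex x y) -` box l u = box (Re l, Im l) (Re u, Im u)"
    by (auto simp: box_def Basis_complex_def Basis_prod_def)
  moreover note borel_measurable_Complex
  moreover have "Re l \<le> Re u" "Im l \<le> Im u"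
    using le[of 1] le[of \<i>] by (auto simp: Basis_complex_def)
  ultimately show "emeasure (distr lborel borel (\<lambda>(x, y). Complex x y)) (box l u) =
      ennreal (\<Prod>b\<in>Basis. (u - l) \<bullet> b)"
    by (subst emeasure_distr)
       (auto simp: emeasure_lborel_box_eq Basis_complex_def Basis_prod_def prod.union_disjoint)
qed simp

lemma emeasure_lborel_complex_slices:
  fixes A :: "complex set"
  assumes "A \<in> sets borel"
  shows "emeasure lborel A = (\<integral>\<^sup>+x. emeasure lborel {y. Complex x y \<in> A} \<partial>lborel)"
proof -
  let ?P = "(\<lambda>(x, y). Complex x y) -` A"
  have P: "?P \<in> sets (borel :: (real \<times> real) measure)"
    using measurable_sets[OF borel_measurable_Complex assms] by simp
  have "emeasure lborel A = emeasure (lborel \<Otimes>\<^sub>M lborel) ?P"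
    using borel_measurable_Complex assms by (subst lborel_eq_distr_Complex, subst emeasure_distr) (auto simp: lborel_prod)
  also have "\<dots> = (\<integral>\<^sup>+x. emeasure lborel (Pair x -` ?P) \<partial>lborel)"
    by (rule lborel.emeasure_pair_measure_alt) (subst lborel_prod, use P in simp)
  finally show ?thesis by (simp add: vimage_def)
qed

text \<open>The same argument on boxes; \<open>real^2\<close> is the setting of
  \<open>measure_bounded_differentiable_image\<close>, which is applied below.\<close>

lemma lborel_eq_distr_vec2:
  "(lborel :: complex measure) = distr (lborel :: (real^2) measure) borel (\<lambda>v. Complex (v$1) (v$2))"
proof (rule lborel_eqI)
  fix l u :: complex
  assume le: "\<And>b. b \<in> Basis \<Longrightarrow> l \<bullet> b \<le> u \<bullet> b"
  have "(\<lambda>v::real^2. Complex (v$1) (v$2)) -` box l u = box (vector [Re l, Im l]) (vector [Re u, Im u])"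
    by (auto simp: box_def Basis_complex_def Basis_vec_def inner_axis UNIV_2)
  moreover note borel_measurable_Complex_vec2
  moreover have "Re l \<le> Re u" "Im l \<le> Im u"
    using le[of 1] le[of \<i>] by (auto simp: Basis_complex_def)
  moreover have "emeasure lborel (box (vector [Re l, Im l]) (vector [Re u, Im u] :: real^2)) =
      ennreal ((Re u - Re l) * (Im u - Im l))"
  proof -
    have B: "(Basis :: (real^2) set) = {axis 1 1, axis 2 1}"
      by (auto simp: Basis_vec_def UNIV_2)
    have ne: "axis 1 (1::real) \<noteq> (axis 2 1 :: real^2)"
      by (simp add: axis_eq_axis)
    show ?thesis
      unfolding emeasure_lborel_box_eq B
      using ne \<open>Re l \<le> Re u\<close> \<open>Im l \<le> Im u\<close> by (simp add: inner_axis)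
  qed
  ultimately show "emeasure (distr lborel borel (\<lambda>v::real^2. Complex (v$1) (v$2))) (box l u) =
      ennreal (\<Prod>b\<in>Basis. (u - l) \<bullet> b)"
    by (subst emeasure_distr) (auto simp: Basis_complex_def)
qed simp

lemma measure_lborel_complex_vec2:
  assumes "A \<in> sets borel"
  shows "measure lborel A = measure lborel ((\<lambda>z. vector [Re z, Im z] :: real^2) ` A)"
proof -
  have "measure lborel A = measure lborel ((\<lambda>v::real^2. Complex (v$1) (v$2)) -` A)"
    using borel_measurable_Complex_vec2 assms by (subst lborel_eq_distr_vec2, subst measure_distr) auto
  also have "(\<lambda>v::real^2. Complex (v$1) (v$2)) -` A = (\<lambda>z. vector [Re z, Im z] :: real^2) ` A"
  proof safe
    fix v :: "real^2" assume v: "Complex (v$1) (v$2) \<in> A"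
    have "v = vector [Re (Complex (v$1) (v$2)), Im (Complex (v$1) (v$2))]"
      by (simp add: vec_eq_iff forall_2)
    with v show "v \<in> (\<lambda>z. vector [Re z, Im z]) ` A" by blast
  qed auto
  finally show ?thesis .
qed

text \<open>Multiplication by \<open>f' z\<close> has real Jacobian |f' z|^2. The maps
  \<open>P\<close> and \<open>Q\<close> pass to \<open>real^2\<close> and back, where the area of a
  differentiable image is bounded by a bound for the Jacobian.\<close>

lemma measure_complex_differentiable_image_le:
  fixes f f' :: "complex \<Rightarrow> complex"
  assumes S: "compact S"
    and der: "\<And>z. z \<in> S \<Longrightarrow> (f has_field_derivative f' z) (at z within S)"
    and cont': "continuous_on S f'"
    and c: "\<And>z. z \<in> S \<Longrightarrow> norm (f' z) \<le> c"
  shows "measure lborel (f ` S) \<le> c\<^sup>2 * measure lborel S"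
proof -
  define P where "P = (\<lambda>z. vector [Re z, Im z] :: real^2)"
  define Q where "Q = (\<lambda>v::real^2. Complex (v$1) (v$2))"
  have QP: "Q (P z) = z" for z by (simp add: P_def Q_def)
  have P_eq: "P z = Re z *\<^sub>R axis 1 1 + Im z *\<^sub>R axis 2 1" for z
    by (simp add: P_def vec_eq_iff forall_2 axis_def)
  have Q_eq: "Q v = complex_of_real (v$1) + \<i> * complex_of_real (v$2)" for v
    by (simp add: Q_def Complex_eq)
  have blP: "bounded_linear P"
    unfolding P_eq[abs_def] by (intro bounded_linear_intros bounded_linear_Re bounded_linear_Im)
  have blQ: "bounded_linear Q"
    unfolding Q_eq[abs_def]
    by (intro bounded_linear_intros bounded_linear_compose[OF bounded_linear_of_real]
      bounded_linear_vec_nth)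
  have contf: "continuous_on S f"
    using der by (rule DERIV_continuous_on)
  have cS: "compact (P ` S)" and cfS: "compact (P ` f ` S)"
    using S contf by (auto intro!: compact_continuous_image linear_continuous_on[OF blP])
  \<comment> \<open>The complex derivative as a real linear map of \<open>real^2\<close>. Its
    determinant is a^2 + b^2 when \<open>f' (Q v)\<close> is a + bi.\<close>
  define D where "D = (\<lambda>v h. P (f' (Q v) * Q h))"
  have QPS: "Q ` P ` S = S" by (force simp: QP image_image)
  have detD: "det (matrix (D v)) = (norm (f' (Q v)))\<^sup>2" for v
    by (simp add: det_2 matrix_def D_def P_def Q_def axis_def cmod_def power2_eq_square)
  have "measure lebesgue ((P \<circ> f \<circ> Q) ` P ` S) \<le> c\<^sup>2 * measure lebesgue (P ` S)"
  proof (rule measure_bounded_differentiable_image)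
    show "P ` S \<in> lmeasurable" using cS by (rule lmeasurable_compact)
    have "continuous_on (P ` S) (\<lambda>v. \<bar>det (matrix (D v))\<bar>)"
      unfolding detD using QPS linear_continuous_on[OF blQ, of "P ` S"]
      by (intro continuous_intros continuous_on_compose2[OF cont']) auto
    then show "(\<lambda>v. \<bar>det (matrix (D v))\<bar>) integrable_on P ` S"
      by (intro set_borel_integral_eq_integral(1) borel_integrable_compact[OF cS, folded set_integrable_def])
    fix v assume "v \<in> P ` S"
    then have z: "Q v \<in> S" using QPS by auto
    have "(f has_derivative (*) (f' (Q v))) (at (Q v) within Q ` P ` S)"
      using der[OF z] by (simp add: QPS has_field_derivative_def)
    then have "(f \<circ> Q has_derivative (\<lambda>h. f' (Q v) * Q h)) (at v within P ` S)"
      using diff_chain_within[OF bounded_linear_imp_has_derivative[OF blQ]] by (auto simp: o_def)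
    then show "((P \<circ> f \<circ> Q) has_derivative D v) (at v within P ` S)"
      using bounded_linear.has_derivative[OF blP] by (auto simp: D_def o_def)
    show "\<bar>det (matrix (D v))\<bar> \<le> c\<^sup>2"
      using c[OF z] by (auto simp: detD intro: power_mono)
  qed
  also have "(P \<circ> f \<circ> Q) ` P ` S = P ` f ` S" by (auto simp: QP image_image)
  finally have "measure lborel (P ` f ` S) \<le> c\<^sup>2 * measure lborel (P ` S)"
    using cS cfS by (simp add: borel_compact)
  then show ?thesis
    unfolding P_def
    using S compact_continuous_image[OF contf S]
    by (simp add: measure_lborel_complex_vec2 borel_compact)
qed

section \<open>Length on the real line: diameters and expanding maps\<close>

lemma subset_interval_of_diam:
  fixes S :: "real set"
  assumes d: "\<And>x y. x \<in> S \<Longrightarrow> y \<in> S \<Longrightarrow> \<bar>x - y\<bar> \<le> d"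
  shows "\<exists>c. S \<subseteq> {c..c + d}"
proof (cases "S = {}")
  case False
  then obtain s where s: "s \<in> S" by auto
  have bdd: "bdd_below S"
    by (rule bdd_belowI[of _ "s - d"]) (use d[OF _ s] in \<open>fastforce simp: abs_le_iff\<close>)
  have "S \<subseteq> {Inf S .. Inf S + d}"
  proof
    fix x assume x: "x \<in> S"
    have "x - d \<le> Inf S"
      by (rule cInf_greatest[OF False]) (use d[OF x] in \<open>fastforce simp: abs_le_iff\<close>)
    then show "x \<in> {Inf S .. Inf S + d}" using cInf_lower[OF x bdd] by auto
  qed
  then show ?thesis ..
qed simp

lemma emeasure_lborel_le_diam:
  fixes S :: "real set"
  assumes d: "\<And>x y. x \<in> S \<Longrightarrow> y \<in> S \<Longrightarrow> \<bar>x - y\<bar> \<le> d"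
  shows "emeasure lborel S \<le> ennreal d"
proof (cases "S = {}")
  case False
  then have "0 \<le> d" using d by fastforce
  moreover obtain c where "S \<subseteq> {c..c + d}" using subset_interval_of_diam[OF d] by auto
  then have "emeasure lborel S \<le> emeasure lborel {c..c + d}" by (intro emeasure_mono) auto
  ultimately show ?thesis by simp
qed simp

text \<open>The inverse of \<open>f\<close> is Lipschitz with constant \<open>L\<close>. Cover
  \<open>T\<close> by nonoverlapping intervals of total length at most
  \<open>measure lborel T + e\<close>: the preimage of each has diameter at most \<open>L\<close>
  times its length, hence lies in an interval of that size. Sum these and let \<open>e\<close> tend
  to 0.\<close>

lemma emeasure_lborel_le_expanding:
  fixes f :: "real \<Rightarrow> real"
  assumes S: "S \<in> sets borel" and T: "compact T" and ST: "f ` S \<subseteq> T" and L: "L > 0"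
    and exp: "\<And>x y. x \<in> S \<Longrightarrow> y \<in> S \<Longrightarrow> \<bar>x - y\<bar> \<le> L * \<bar>f x - f y\<bar>"
  shows "emeasure lborel S \<le> ennreal L * emeasure lborel T"
proof -
  obtain a b where Tab: "T \<subseteq> cbox a b"
    using bounded_subset_cbox_symmetric[OF compact_imp_bounded[OF T]] by blast
  have mT: "emeasure lborel T = ennreal (measure lborel T)"
    using emeasure_compact_finite[OF T] by (simp add: emeasure_eq_ennreal_measure top.not_eq_extremum)
  have bound: "emeasure lborel S \<le> ennreal (L * (measure lborel T + e))" if e: "e > 0" for e
  proof -
    obtain \<D> where cD: "countable \<D>"
      and box: "\<And>K. K \<in> \<D> \<Longrightarrow> \<exists>c d. K = cbox c d"
      and disj: "pairwise (\<lambda>A B. interior A \<inter> interior B = {}) \<D>"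
      and cov: "T \<subseteq> \<Union>\<D>" and mD: "\<Union>\<D> \<in> lmeasurable"
      and leD: "measure lebesgue (\<Union>\<D>) \<le> measure lebesgue T + e"
      using measurable_outer_intervals_bounded[OF lmeasurable_compact[OF T] Tab e] by metis
    \<comment> \<open>The length of \<open>K\<close> is expressed through its interior: members of
      \<open>\<D>\<close> may share endpoints, but their interiors are disjoint, so the lengths add
      up to the measure of a union.\<close>
    have "\<exists>J. closed J \<and> {x \<in> S. f x \<in> K} \<subseteq> J \<and>
        emeasure lborel J \<le> ennreal L * emeasure lborel (interior K)" if K: "K \<in> \<D>" for K
    proof -
      obtain u v where uv: "K = {u..v}" using box[OF K] by auto
      show ?thesis
      proof (cases "u \<le> v")
        case True
        have "\<bar>x - y\<bar> \<le> L * (v - u)" if "x \<in> {x \<in> S. f x \<in> K}" "y \<in> {x \<in> S. f x \<in> K}" for x y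
        proof -
          have "\<bar>x - y\<bar> \<le> L * \<bar>f x - f y\<bar>" using exp that by auto
          also have "\<dots> \<le> L * (v - u)"
            using that uv L by (intro mult_left_mono) (auto simp: abs_le_iff)
          finally show ?thesis .
        qed
        from subset_interval_of_diam[OF this]
        obtain c where "{x \<in> S. f x \<in> K} \<subseteq> {c..c + L * (v - u)}" by blast
        moreover have "emeasure lborel {c..c + L * (v - u)} = ennreal L * emeasure lborel (interior K)"
          using True L uv by (simp add: ennreal_mult)
        ultimately show ?thesis by (metis closed_atLeastAtMost order_refl)
      next
        case False
        then have "K = {}" using uv by simp
        then show ?thesis by (intro exI[of _ "{}"]) auto
      qed
    qed
    then obtain J where J: "\<And>K. K \<in> \<D> \<Longrightarrow> closed (J K)"
      "\<And>K. K \<in> \<D> \<Longrightarrow> {x \<in> S. f x \<in> K} \<subseteq> J K"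
      "\<And>K. K \<in> \<D> \<Longrightarrow> emeasure lborel (J K) \<le> ennreal L * emeasure lborel (interior K)"
      by metis
    define N where "N = to_nat_on \<D> ` \<D>"
    define k where "k = from_nat_into \<D>"
    have kN: "k n \<in> \<D>" "to_nat_on \<D> (k n) = n" if "n \<in> N" for n
      using that cD by (auto simp: N_def k_def)
    define J' where "J' = (\<lambda>n. if n \<in> N then J (k n) else {})"
    define I' where "I' = (\<lambda>n. if n \<in> N then interior (k n) else {})"
    have "S \<subseteq> (\<Union>n. J' n)"
    proof
      fix x assume x: "x \<in> S"
      then obtain K where K: "K \<in> \<D>" "f x \<in> K" using ST cov by blast
      then have "to_nat_on \<D> K \<in> N" "k (to_nat_on \<D> K) = K"
        using cD by (auto simp: N_def k_def)
      then have "x \<in> J' (to_nat_on \<D> K)" using J(2)[OF K(1)] x K by (auto simp: J'_def)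
      then show "x \<in> (\<Union>n. J' n)" by blast
    qed
    moreover have J'b: "J' n \<in> sets lborel" for n
      using J(1) kN(1) by (auto simp: J'_def)
    ultimately have "emeasure lborel S \<le> emeasure lborel (\<Union>n. J' n)"
      by (intro emeasure_mono) auto
    also have "\<dots> \<le> (\<Sum>n. emeasure lborel (J' n))"
      using J'b by (intro emeasure_subadditive_countably) auto
    also have "\<dots> \<le> (\<Sum>n. ennreal L * emeasure lborel (I' n))"
      using J(3) kN(1) by (intro suminf_le) (auto simp: J'_def I'_def)
    also have "\<dots> = ennreal L * (\<Sum>n. emeasure lborel (I' n))"
      by (rule ennreal_suminf_cmult)
    also have "(\<Sum>n. emeasure lborel (I' n)) = emeasure lborel (\<Union>n. I' n)"
    proof (rule suminf_emeasure)
      show "range I' \<subseteq> sets lborel" by (auto simp: I'_def)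
      show "disjoint_family I'"
        unfolding disjoint_family_on_def
      proof safe
        fix m n x assume "m \<noteq> n" "x \<in> I' m" "x \<in> I' n"
        then have mn: "m \<in> N" "n \<in> N" "x \<in> interior (k m)" "x \<in> interior (k n)"
          by (auto simp: I'_def split: if_splits)
        then have "k m \<noteq> k n" using kN(2) \<open>m \<noteq> n\<close> by metis
        then show "x \<in> {}" using pairwiseD[OF disj kN(1)[OF mn(1)] kN(1)[OF mn(2)]] mn by auto
      qed
    qed
    also have "emeasure lborel (\<Union>n. I' n) \<le> emeasure lebesgue (\<Union>\<D>)"
    proof -
      have "(\<Union>n. I' n) \<subseteq> \<Union>\<D>"
        using interior_subset kN(1) by (fastforce simp: I'_def split: if_splits)
      moreover have "(\<Union>n. I' n) \<in> sets borel" by (auto simp: I'_def)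
      moreover have "emeasure lborel (\<Union>n. I' n) = emeasure lebesgue (\<Union>n. I' n)"
        using \<open>(\<Union>n. I' n) \<in> sets borel\<close> by simp
      ultimately show ?thesis
        using fmeasurableD[OF mD] by (metis emeasure_mono)
    qed
    also have "emeasure lebesgue (\<Union>\<D>) \<le> ennreal (measure lborel T + e)"
      using leD T mD by (simp add: emeasure_eq_measure2 borel_compact ennreal_leI)
    finally show ?thesis
      using L by (simp add: ennreal_mult' mult_left_mono)
  qed
  have "emeasure lborel S \<le> ennreal (L * measure lborel T)"
  proof (rule ennreal_le_epsilon)
    fix e :: real assume "e > 0"
    then show "emeasure lborel S \<le> ennreal (L * measure lborel T) + ennreal e"
      using bound[of "e / L"] L by (simp add: distrib_left ennreal_plus[symmetric] del: ennreal_plus)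
  qed
  then show ?thesis using L mT by (simp add: ennreal_mult')
qed

section \<open>Comparing areas slice by slice\<close>

lemma borel_measurable_complex_slices:
  fixes A :: "complex set"
  assumes "A \<in> sets borel"
  shows "(\<lambda>x. emeasure lborel {y. Complex x y \<in> A}) \<in> borel_measurable borel"
proof -
  let ?P = "(\<lambda>(x, y). Complex x y) -` A"
  have P: "?P \<in> sets (borel :: (real \<times> real) measure)"
    using measurable_sets[OF borel_measurable_Complex assms] by simp
  have "(\<lambda>x. emeasure lborel (Pair x -` ?P)) \<in> borel_measurable lborel"
    by (rule lborel.measurable_emeasure_Pair) (subst lborel_prod, use P in simp)
  then show ?thesis by (simp add: vimage_def)
qed

text \<open>Integrate the slice estimate over \<open>x\<close>; the substitution
  \<open>c + lam * x\<close> in the integral for \<open>B\<close> contributes the factor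
  \<open>1 / lam\<close>.\<close>

lemma measure_le_of_scaled_slices:
  fixes A B :: "complex set"
  assumes A: "compact A" and B: "compact B" and lam: "lam > 0" and C: "C \<ge> 0"
    and le: "\<And>x. emeasure lborel {y. Complex x y \<in> A}
        \<le> ennreal C * emeasure lborel {t. Complex (c + lam * x) t \<in> B}"
  shows "measure lborel A \<le> C / lam * measure lborel B"
proof -
  let ?b = "\<lambda>x. emeasure lborel {t. Complex x t \<in> B}"
  have mb [measurable]: "?b \<in> borel_measurable borel"
    using B by (intro borel_measurable_complex_slices borel_compact)
  have fin: "emeasure lborel A = ennreal (measure lborel A)"
      "emeasure lborel B = ennreal (measure lborel B)"
    using emeasure_compact_finite[OF A] emeasure_compact_finite[OF B]
    by (simp_all add: emeasure_eq_ennreal_measure top.not_eq_extremum)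
  have "emeasure lborel A \<le> (\<integral>\<^sup>+x. ennreal C * ?b (c + lam * x) \<partial>lborel)"
    unfolding emeasure_lborel_complex_slices[OF borel_compact[OF A]]
    by (intro nn_integral_mono le)
  also have "\<dots> = ennreal C * (\<integral>\<^sup>+x. ?b (c + lam * x) \<partial>lborel)"
    by (rule nn_integral_cmult) simp
  finally have "ennreal lam * emeasure lborel A
      \<le> ennreal C * (ennreal lam * (\<integral>\<^sup>+x. ?b (c + lam * x) \<partial>lborel))"
    by (metis mult.left_commute mult_left_mono zero_le)
  also have "ennreal lam * (\<integral>\<^sup>+x. ?b (c + lam * x) \<partial>lborel) = emeasure lborel B"
    unfolding emeasure_lborel_complex_slices[OF borel_compact[OF B]]
    using nn_integral_real_affine[OF mb, of lam c] lam by simp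
  finally have "ennreal (lam * measure lborel A) \<le> ennreal (C * measure lborel B)"
    using lam C by (simp add: fin ennreal_mult')
  then have "lam * measure lborel A \<le> C * measure lborel B"
    using C by (simp add: ennreal_le_iff)
  then show ?thesis using lam by (simp add: field_simps)
qed

lemma compact_complex_slice:
  assumes "compact A"
  shows "compact {y. Complex x y \<in> A}"
proof -
  have "{y. Complex x y \<in> A} = Im ` (A \<inter> {z. Re z = x})"
    by (force simp: image_iff complex_eq_iff)
  moreover have "closed {z. Re z = x}"
    by (intro closed_Collect_eq continuous_intros)
  ultimately show ?thesis
    using assms by (auto intro!: compact_continuous_image continuous_intros compact_Int_closed)
qed

section \<open>Chords and arcs of the unit circle\<close>

lemma norm_exp_ii_diff_le:
  "norm (exp (\<i> * complex_of_real s) - exp (\<i> * complex_of_real t)) \<le> \<bar>s - t\<bar>"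
proof -
  have "exp (\<i> * complex_of_real s) - exp (\<i> * complex_of_real t)
      = exp (\<i> * complex_of_real t) * (exp (\<i> * complex_of_real (s - t)) - 1)"
    by (simp add: exp_diff right_diff_distrib)
  then have "norm (exp (\<i> * complex_of_real s) - exp (\<i> * complex_of_real t))
      = 2 * \<bar>sin ((s - t) / 2)\<bar>"
    using dist_exp_i_1[of "s - t"] by (simp add: norm_mult)
  then show ?thesis using abs_sin_x_le_abs_x[of "(s - t) / 2"] by simp
qed

text \<open>\<open>Im (Ln z)\<close> is the principal argument, and a chord is no longer than any
  arc joining its ends. Continuity of the argument plays no part in this, so points on opposite
  sides of the branch cut are covered.\<close>

lemma norm_unit_diff_le_Arg:
  fixes z w :: complex
  assumes "norm z = 1" "norm w = 1"
  shows "norm (z - w) \<le> \<bar>Im (Ln z) - Im (Ln w)\<bar>"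
proof -
  have *: "exp (\<i> * complex_of_real (Im (Ln u))) = u" if "norm u = 1" for u :: complex
  proof -
    have "u \<noteq> 0" using that by auto
    moreover have "Ln u = \<i> * complex_of_real (Im (Ln u))"
      using that \<open>u \<noteq> 0\<close> by (simp add: complex_eq_iff Re_Ln)
    ultimately show ?thesis by (metis exp_Ln)
  qed
  then show ?thesis
    using norm_exp_ii_diff_le[of "Im (Ln z)" "Im (Ln w)"] assms by simp
qed

text \<open>As the real parts are nonnegative, |Re z - Re w| is at most Re z + Re w, so (Re z - Re
  w)^2 is at most |(Re z)^2 - (Re w)^2| = |(Im z)^2 - (Im w)^2|, which is at most 2d. The square
  root reflects the points \<i> and -\<i>, where the imaginary part is stationary along the
  circle.\<close>

lemma norm_unit_half_circle_diff_le:
  fixes z w :: complex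
  assumes "norm z = 1" "norm w = 1" "0 \<le> Re z" "0 \<le> Re w" and d: "\<bar>Im z - Im w\<bar> \<le> d"
  shows "norm (z - w) \<le> 2 * sqrt d"
proof -
  have z: "(Re z)\<^sup>2 + (Im z)\<^sup>2 = 1" and w: "(Re w)\<^sup>2 + (Im w)\<^sup>2 = 1"
    using assms(1,2) by (simp_all add: cmod_def)
  have b: "\<bar>Im z\<bar> \<le> 1" "\<bar>Im w\<bar> \<le> 1"
    using assms(1,2) abs_Im_le_cmod[of z] abs_Im_le_cmod[of w] by auto
  have "(Im z - Im w)\<^sup>2 = \<bar>Im z - Im w\<bar> * \<bar>Im z - Im w\<bar>"
    by (simp add: power2_eq_square)
  also have "\<dots> \<le> d * 2"
    using d b by (intro mult_mono) (auto simp: abs_le_iff)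
  finally have 1: "(Im z - Im w)\<^sup>2 \<le> 2 * d" by simp
  have "(Re z - Re w)\<^sup>2 \<le> \<bar>Re z - Re w\<bar> * (Re z + Re w)"
    unfolding power2_eq_square using assms(3,4)
    by (subst abs_mult_self_eq[symmetric]) (intro mult_left_mono, auto simp: abs_le_iff)
  also have "\<dots> = \<bar>(Re z)\<^sup>2 - (Re w)\<^sup>2\<bar>"
    using assms(3,4) by (simp add: square_diff_square_factored power2_eq_square abs_mult)
  also have "(Re z)\<^sup>2 - (Re w)\<^sup>2 = (Im w - Im z) * (Im w + Im z)"
    using z w by (simp add: algebra_simps power2_eq_square)
  also have "\<bar>\<dots>\<bar> \<le> d * 2"
    unfolding abs_mult using d b by (intro mult_mono) (auto simp: abs_le_iff)
  finally have "(norm (z - w))\<^sup>2 \<le> 4 * d"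
    using 1 by (simp add: cmod_power2)
  then have "norm (z - w) \<le> sqrt (4 * d)"
    by (rule real_le_rsqrt)
  then show ?thesis by (simp add: real_sqrt_mult)
qed

section \<open>Horizontal blocks and strips of the folding\<close>

text \<open>The edges of the blocks are the lines of reflection of the map, so a single formula
  holds on each block.\<close>

definition fold_block :: "int \<Rightarrow> complex set" where
  "fold_block j = {z. \<bar>Im z - 2 * sqrt 2 * of_int j\<bar> \<le> sqrt 2}"

text \<open>The blocks shifted by half their height: a strip lies between the centre lines of two
  consecutive blocks, and these lines are mapped into the real axis.\<close>

definition fold_strip :: "int \<Rightarrow> complex set" where
  "fold_strip m = {z. 2 * sqrt 2 * of_int m \<le> Im z \<and> Im z \<le> 2 * sqrt 2 * of_int (m + 1)}"

text \<open>The folded height: an odd block is reached by an odd number of reflections, which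
  reverses the direction of \<open>y\<close>.\<close>

definition fold_coord :: "int \<Rightarrow> real \<Rightarrow> real" where
  "fold_coord j y = (if even j then y - 2 * sqrt 2 * of_int j else 2 * sqrt 2 * of_int j - y)"

lemma fold_coord_diff: "\<bar>fold_coord j y - fold_coord j y'\<bar> = \<bar>y - y'\<bar>"
  by (auto simp: fold_coord_def)

lemma fold_coord_bound: "z \<in> fold_block j \<Longrightarrow> \<bar>fold_coord j (Im z)\<bar> \<le> sqrt 2"
  by (auto simp: fold_coord_def fold_block_def)

lemma continuous_on_fold_coord: "continuous_on S (fold_coord j)"
  unfolding fold_coord_def[abs_def] by (cases "even j") (auto intro!: continuous_intros)

lemma closed_fold_block: "closed (fold_block j)"
  unfolding fold_block_def by (intro closed_Collect_le continuous_intros)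

lemma fold_strip_subset: "fold_strip m \<subseteq> fold_block m \<union> fold_block (m + 1)"
proof
  fix z assume "z \<in> fold_strip m"
  then show "z \<in> fold_block m \<union> fold_block (m + 1)"
    by (cases "Im z \<le> 2 * sqrt 2 * of_int m + sqrt 2")
       (auto simp: fold_strip_def fold_block_def abs_le_iff algebra_simps)
qed

lemma mem_fold_strip_floor: "z \<in> fold_strip \<lfloor>Im z / (2 * sqrt 2)\<rfloor>"
proof -
  define q where "q = Im z / (2 * sqrt 2)"
  have "of_int \<lfloor>q\<rfloor> \<le> q" "q \<le> of_int (\<lfloor>q\<rfloor> + 1)"
    by linarith+
  moreover have "Im z = 2 * sqrt 2 * q" by (simp add: q_def)
  ultimately show ?thesis
    unfolding fold_strip_def q_def[symmetric] by (auto intro!: mult_left_mono)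
qed

lemma fold_block_cover: "\<exists>j. z \<in> fold_block j"
  using mem_fold_strip_floor fold_strip_subset by blast

text \<open>The imaginary parts of \<open>W\<close> form an interval without multiples of 2 sqrt 2,
  so it stays between the two multiples around any one of its points.\<close>

lemma connected_subset_fold_strip:
  assumes W: "connected W" and off: "\<And>z m. z \<in> W \<Longrightarrow> Im z \<noteq> 2 * sqrt 2 * of_int m"
  shows "\<exists>m. W \<subseteq> fold_strip m"
proof (cases "W = {}")
  case False
  then obtain w where w: "w \<in> W" by auto
  define m where "m = \<lfloor>Im w / (2 * sqrt 2)\<rfloor>"
  have wm: "2 * sqrt 2 * of_int m \<le> Im w" "Im w \<le> 2 * sqrt 2 * of_int (m + 1)"
    using mem_fold_strip_floor[of w] by (auto simp: m_def fold_strip_def)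
  have conn: "connected (Im ` W)"
    using W by (intro connected_continuous_image continuous_intros)
  have no: "2 * sqrt 2 * of_int k \<notin> Im ` W" for k :: int
    using off by (metis imageE)
  have "z \<in> fold_strip m" if "z \<in> W" for z
    unfolding fold_strip_def
  proof (rule CollectI, intro conjI; rule ccontr)
    assume "\<not> 2 * sqrt 2 * of_int m \<le> Im z"
    then have "2 * sqrt 2 * of_int m \<in> Im ` W"
      using connectedD_interval[OF conn, of "Im z" "Im w" "2 * sqrt 2 * of_int m"] w that wm by auto
    then show False using no by blast
  next
    assume "\<not> Im z \<le> 2 * sqrt 2 * of_int (m + 1)"
    then have "2 * sqrt 2 * of_int (m + 1) \<in> Im ` W"
      using connectedD_interval[OF conn, of "Im w" "Im z" "2 * sqrt 2 * of_int (m + 1)"] w that wm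
      by auto
    then show False using no by blast
  qed
  then show ?thesis by blast
qed simp

section \<open>Inner regularity\<close>

lemma lebesgue_pos_compact_subset:
  fixes V :: "'a::euclidean_space set"
  assumes V: "V \<in> sets lebesgue" and pos: "emeasure lebesgue V > 0"
  obtains K where "compact K" "K \<subseteq> V" "measure lborel K > 0"
proof -
  \<comment> \<open>The measure of \<open>V\<close> may be infinite. Removing a set of measure below
    this \<open>e\<close> leaves a closed set that is not null.\<close>
  obtain e :: real where e: "0 < e" "ennreal e < emeasure lebesgue V"
    using dense[OF pos] by (metis ennreal_cases ennreal_less_zero_iff top.extremum_strict)
  obtain T where T: "closed T" "T \<subseteq> V" "V - T \<in> lmeasurable" "emeasure lebesgue (V - T) < ennreal e"
    using sets_lebesgue_inner_closed[OF V e(1)] .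
  have "emeasure lebesgue T \<noteq> 0"
  proof
    assume "emeasure lebesgue T = 0"
    moreover have "emeasure lebesgue V \<le> emeasure lebesgue (T \<union> (V - T))"
      using T V by (intro emeasure_mono) auto
    moreover have "emeasure lebesgue (T \<union> (V - T)) \<le> emeasure lebesgue T + emeasure lebesgue (V - T)"
      using T by (intro emeasure_subadditive) (auto simp: borel_closed)
    ultimately show False using T(4) e(2) by (simp add: not_less)
  qed
  \<comment> \<open>Balls of integer radius exhaust \<open>T\<close>; if all the pieces were null,
    so would be \<open>T\<close>.\<close>
  then have "\<exists>n. emeasure lborel (T \<inter> cball 0 (real n)) \<noteq> 0"
  proof (rule contrapos_np)
    assume "\<nexists>n. emeasure lborel (T \<inter> cball 0 (real n)) \<noteq> 0"
    then have "(\<Union>n. T \<inter> cball 0 (real n)) \<in> null_sets lborel"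
      using T(1) by (intro null_sets_UN) (auto intro!: null_setsI borel_closed)
    moreover have "(\<Union>n. T \<inter> cball 0 (real n)) = T"
      by (auto simp: real_arch_simple)
    ultimately show "emeasure lebesgue T = 0"
      using T(1) by (auto simp: null_sets_def)
  qed
  then obtain n where n: "emeasure lborel (T \<inter> cball 0 (real n)) \<noteq> 0" by blast
  have cp: "compact (T \<inter> cball 0 (real n))" using T(1) by (intro closed_Int_compact) auto
  then have "measure lborel (T \<inter> cball 0 (real n)) > 0"
    using n emeasure_compact_finite[OF cp]
    by (simp add: measure_def enn2real_positive_iff zero_less_iff_neq_zero)
  with cp T(2) show thesis by (intro that[of "T \<inter> cball 0 (real n)"]) auto
qed

section \<open>Folded exponentials and their expansion of area\<close>

text \<open>\<open>\<phi>\<close> is the curve a + ib on the right half of the unit circle,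
  \<open>expand\<close> is the lower bi-Lipschitz bound, and \<open>phi_0\<close> makes
  \<open>g\<close> real on the centre line of each block. \<open>g_block\<close> is demanded of
  every block, so the formulas of two neighbours agree on their common edge.\<close>

locale folded_exponential =
  fixes \<phi> :: "real \<Rightarrow> complex" and L lam nu :: real and g :: "complex \<Rightarrow> complex"
  assumes L: "L > 0" and lam: "lam > 0" and nu: "nu > 0"
    and norm_phi: "\<And>y. \<bar>y\<bar> \<le> sqrt 2 \<Longrightarrow> norm (\<phi> y) = 1"
    and Re_phi: "\<And>y. \<bar>y\<bar> \<le> sqrt 2 \<Longrightarrow> 0 \<le> Re (\<phi> y)"
    and phi_0: "Im (\<phi> 0) = 0"
    and cont_phi: "continuous_on {-sqrt 2..sqrt 2} \<phi>"
    and expand: "\<And>y y'. \<bar>y\<bar> \<le> sqrt 2 \<Longrightarrow> \<bar>y'\<bar> \<le> sqrt 2 \<Longrightarrow> \<bar>y - y'\<bar> \<le> L * norm (\<phi> y - \<phi> y')"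
    and g_block: "\<And>z j. z \<in> fold_block j \<Longrightarrow>
      g z = complex_of_real (nu * exp (lam * Re z)) * \<phi> (fold_coord j (Im z))"
begin

lemma norm_g: "norm (g z) = nu * exp (lam * Re z)"
proof -
  obtain j where "z \<in> fold_block j" using fold_block_cover by blast
  then show ?thesis using nu by (simp add: g_block norm_mult norm_phi fold_coord_bound)
qed

lemma Re_g_nonneg: "0 \<le> Re (g z)"
proof -
  obtain j where "z \<in> fold_block j" using fold_block_cover by blast
  then show ?thesis using nu by (simp add: g_block Re_phi fold_coord_bound)
qed

lemma g_real: "Im z = 2 * sqrt 2 * of_int m \<Longrightarrow> g z \<in> \<real>"
  using g_block[of z m] phi_0 by (simp add: fold_block_def fold_coord_def complex_is_Real_iff)

lemma continuous_on_g_block: "continuous_on (fold_block j) g"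
proof -
  have "continuous_on (fold_block j) (\<lambda>z. \<phi> (fold_coord j (Im z)))"
    using fold_coord_bound
    by (intro continuous_on_compose2[OF cont_phi] continuous_on_compose2[OF continuous_on_fold_coord[of UNIV]]
          continuous_intros) (fastforce simp: abs_le_iff)+
  then have "continuous_on (fold_block j)
      (\<lambda>z. complex_of_real (nu * exp (lam * Re z)) * \<phi> (fold_coord j (Im z)))"
    by (intro continuous_intros)
  then show ?thesis by (rule continuous_on_eq) (simp add: g_block)
qed

lemma continuous_on_g_strip: "continuous_on (fold_strip m) g"
  using continuous_on_closed_Un[OF closed_fold_block closed_fold_block
      continuous_on_g_block continuous_on_g_block] fold_strip_subset
  by (rule continuous_on_subset)

text \<open>The logarithm of g(A) is a sheared copy of A: its slices over ln nu + lam x are the images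
  of the slices of A over x under the inverse-Lipschitz map y \<mapsto> Arg (phi y'), and the logarithm has
  Jacobian 1/|w|^2.\<close>
lemma measure_le_image_block:
  assumes A: "compact A" "A \<subseteq> fold_block j" and x0: "\<And>z. z \<in> A \<Longrightarrow> x0 \<le> Re z"
  shows "measure lborel A \<le> L / (lam * (nu * exp (lam * x0))\<^sup>2) * measure lborel (g ` A)"
proof -
  define r where "r = nu * exp (lam * x0)"
  have r: "r > 0" using nu by (simp add: r_def)
  have cW: "compact (g ` A)"
    using A by (intro compact_continuous_image continuous_on_subset[OF continuous_on_g_block])
  \<comment> \<open>The image stays in the closed right half-plane and away from 0, hence off the
    branch cut of \<open>Ln\<close>, and the derivative of \<open>Ln\<close> is at most
    \<open>1 / r\<close> in modulus there.\<close>
  have W: "r \<le> norm w" "0 \<le> Re w" "w \<notin> \<real>\<^sub>\<le>\<^sub>0" if w: "w \<in> g ` A" for w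
  proof -
    obtain z where z: "z \<in> A" "w = g z" using w by auto
    show 1: "r \<le> norm w" using x0[OF z(1)] nu lam by (simp add: z(2) norm_g r_def)
    show 2: "0 \<le> Re w" by (simp add: z(2) Re_g_nonneg)
    show "w \<notin> \<real>\<^sub>\<le>\<^sub>0"
    proof
      assume "w \<in> \<real>\<^sub>\<le>\<^sub>0"
      then have "w = 0" using 2 by (auto simp: complex_nonpos_Reals_iff complex_eq_iff)
      then show False using 1 r by simp
    qed
  qed
  have nz: "w \<noteq> 0" if "w \<in> g ` A" for w using W[OF that] by auto
  have Ln_le: "measure lborel (Ln ` g ` A) \<le> (1 / r)\<^sup>2 * measure lborel (g ` A)"
  proof (rule measure_complex_differentiable_image_le[OF cW, where f' = inverse])
    show "(Ln has_field_derivative inverse w) (at w within g ` A)" if "w \<in> g ` A" for w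
      using W(3)[OF that] by (rule has_field_derivative_at_within[OF has_field_derivative_Ln])
    show "continuous_on (g ` A) inverse" using nz by (intro continuous_intros) auto
    show "norm (inverse w) \<le> 1 / r" if "w \<in> g ` A" for w
      using le_imp_inverse_le[OF W(1)[OF that] r] by (simp add: norm_divide inverse_eq_divide)
  qed
  have cB: "compact (Ln ` g ` A)"
    using W(3) by (intro compact_continuous_image[OF _ cW] continuous_on_Ln) auto
  have "measure lborel A \<le> L / lam * measure lborel (Ln ` g ` A)"
  proof (rule measure_le_of_scaled_slices[OF A(1) cB lam, where c = "ln nu"])
    show "L \<ge> 0" using L by simp
    fix x
    let ?S = "{y. Complex x y \<in> A}" and ?T = "{t. Complex (ln nu + lam * x) t \<in> Ln ` g ` A}"
    \<comment> \<open>Over a fixed \<open>x\<close>, the logarithm of \<open>g\<close> has the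
      constant real part \<open>ln nu + lam * x\<close> and the imaginary part
      \<open>?f y\<close>.\<close>
    let ?f = "\<lambda>y. Im (Ln (\<phi> (fold_coord j y)))"
    show "emeasure lborel ?S \<le> ennreal L * emeasure lborel ?T"
    proof (rule emeasure_lborel_le_expanding[OF borel_compact[OF compact_complex_slice[OF A(1)]]
          compact_complex_slice[OF cB] _ L])
      have bd: "\<bar>fold_coord j y\<bar> \<le> sqrt 2" if "y \<in> ?S" for y
        using fold_coord_bound[of "Complex x y" j] that A(2) by auto
      show "?f ` ?S \<subseteq> ?T"
      proof (rule image_subsetI, rule CollectI)
        fix y assume y: "y \<in> ?S"
        have n1: "norm (\<phi> (fold_coord j y)) = 1" using bd[OF y] norm_phi by blast
        then have n0: "\<phi> (fold_coord j y) \<noteq> 0" by auto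
        have p: "nu * exp (lam * x) > 0" using nu by simp
        have "g (Complex x y) = complex_of_real (nu * exp (lam * x)) * \<phi> (fold_coord j y)"
          using y A(2) g_block[of "Complex x y" j] by auto
        then have "Ln (g (Complex x y))
            = complex_of_real (ln (nu * exp (lam * x))) + Ln (\<phi> (fold_coord j y))"
          by (simp only: Ln_times_of_real[OF p n0] Ln_of_real[OF p])
        also have "\<dots> = Complex (ln nu + lam * x) (?f y)"
          using nu n0 n1 by (simp add: complex_eq_iff Re_Ln ln_mult)
        finally show "Complex (ln nu + lam * x) (?f y) \<in> Ln ` g ` A"
          using y by (metis imageI mem_Collect_eq)
      qed
      show "\<bar>y - y'\<bar> \<le> L * \<bar>?f y - ?f y'\<bar>" if "y \<in> ?S" "y' \<in> ?S" for y y'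
      proof -
        have "\<bar>y - y'\<bar> \<le> L * norm (\<phi> (fold_coord j y) - \<phi> (fold_coord j y'))"
          using expand[OF bd[OF that(1)] bd[OF that(2)]] by (simp add: fold_coord_diff)
        also have "\<dots> \<le> L * \<bar>?f y - ?f y'\<bar>"
          using L bd that by (intro mult_left_mono norm_unit_diff_le_Arg norm_phi) auto
        finally show ?thesis .
      qed
    qed
  qed
  also have "\<dots> \<le> L / lam * ((1 / r)\<^sup>2 * measure lborel (g ` A))"
    using Ln_le L lam by (intro mult_left_mono) auto
  finally show ?thesis by (simp add: r_def power_divide)
qed

lemma compact_image_strip: "compact A \<Longrightarrow> A \<subseteq> fold_strip m \<Longrightarrow> compact (g ` A)"
  by (intro compact_continuous_image continuous_on_subset[OF continuous_on_g_strip])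

text \<open>Two neighbouring blocks cover a strip, whence the factor 2.\<close>

lemma measure_strip_le_blocks:
  assumes A: "compact A" "A \<subseteq> fold_strip m"
    and C: "\<And>j. measure lborel (A \<inter> fold_block j) \<le> C"
  shows "measure lborel A \<le> 2 * C"
proof -
  have cp: "compact (A \<inter> fold_block j)" for j
    using A(1) closed_fold_block by (rule compact_Int_closed)
  have "A = (A \<inter> fold_block m) \<union> (A \<inter> fold_block (m + 1))"
    using A(2) fold_strip_subset by blast
  then have "measure lborel A \<le> measure lborel (A \<inter> fold_block m) + measure lborel (A \<inter> fold_block (m + 1))"
    using measure_Un_le[of "A \<inter> fold_block m" lborel "A \<inter> fold_block (m + 1)"] cp
    by (metis borel_compact sets_lborel)
  then show ?thesis using C[of m] C[of "m + 1"] by simp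
qed

text \<open>The halves of \<open>A\<close> in the two blocks may have overlapping images, so each
  half is compared with the whole image of \<open>A\<close>. This doubling is the source of the 2 in
  the condition \<open>nu\<^sup>2 * lam > 2 * L\<close>.\<close>

lemma measure_le_image_strip:
  assumes A: "compact A" "A \<subseteq> fold_strip m" and x0: "\<And>z. z \<in> A \<Longrightarrow> x0 \<le> Re z"
  shows "measure lborel A \<le> 2 * (L / (lam * (nu * exp (lam * x0))\<^sup>2) * measure lborel (g ` A))"
proof (rule measure_strip_le_blocks[OF A])
  fix j
  have "measure lborel (A \<inter> fold_block j)
      \<le> L / (lam * (nu * exp (lam * x0))\<^sup>2) * measure lborel (g ` (A \<inter> fold_block j))"
    using x0 by (intro measure_le_image_block compact_Int_closed[OF A(1) closed_fold_block]) auto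
  also have "\<dots> \<le> L / (lam * (nu * exp (lam * x0))\<^sup>2) * measure lborel (g ` A)"
  proof (intro mult_left_mono measure_mono_fmeasurable)
    show "g ` A \<in> fmeasurable lborel"
      using compact_image_strip[OF A] by (simp add: fmeasurable_compact)
    have "compact (g ` (A \<inter> fold_block j))"
      using A by (intro compact_image_strip[of _ m] compact_Int_closed closed_fold_block) auto
    then show "g ` (A \<inter> fold_block j) \<in> sets lborel" by (simp add: borel_compact)
  qed (use L lam in auto)
  finally show "measure lborel (A \<inter> fold_block j) \<le> L / (lam * (nu * exp (lam * x0))\<^sup>2) * measure lborel (g ` A)" .
qed

section \<open>Area bound for sets whose image lies in a strip\<close>

text \<open>The slice over \<open>x\<close> is mapped to a half circle of radius p = nu e^(lam x),
  and the imaginary parts of its image differ by at most 2 sqrt 2. After division by p, the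
  half-circle estimate and \<open>expand\<close> bound the diameter of the slice by 2 L sqrt(2 sqrt
  2 / p), which is \<open>D * exp (- lam * x / 2)\<close>.\<close>

lemma measure_block_into_strip_le:
  assumes A: "compact A" "A \<subseteq> fold_block j" and x0: "\<And>z. z \<in> A \<Longrightarrow> 0 \<le> Re z"
    and gA: "g ` A \<subseteq> fold_strip m"
  shows "measure lborel A \<le> 4 * L * sqrt (2 * sqrt 2 / nu) / lam"
proof -
  define D where "D = 2 * L * sqrt (2 * sqrt 2 / nu)"
  have D: "D \<ge> 0" using L nu by (simp add: D_def)
  let ?h = "\<lambda>x. D * exp (- lam * x / 2)"
  have slice: "emeasure lborel {y. Complex x y \<in> A} \<le> ennreal (?h x) * indicator {0..} x" for x
  proof (cases "x \<ge> 0")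
    case False
    then have "{y. Complex x y \<in> A} = {}" using x0 by force
    then show ?thesis by simp
  next
    case True
    define p where "p = nu * exp (lam * x)"
    have p: "p > 0" using nu by (simp add: p_def)
    have "\<bar>y - y'\<bar> \<le> ?h x" if y: "Complex x y \<in> A" "Complex x y' \<in> A" for y y'
    proof -
      let ?u = "fold_coord j y" and ?v = "fold_coord j y'"
      have u: "\<bar>?u\<bar> \<le> sqrt 2" "\<bar>?v\<bar> \<le> sqrt 2"
        using fold_coord_bound[of "Complex x y" j] fold_coord_bound[of "Complex x y'" j] y A(2) by auto
      have Img: "Im (g (Complex x y)) = p * Im (\<phi> ?u)" "Im (g (Complex x y')) = p * Im (\<phi> ?v)"
        using y A(2) g_block[of "Complex x y" j] g_block[of "Complex x y'" j] by (auto simp: p_def)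
      have "g (Complex x y) \<in> fold_strip m" "g (Complex x y') \<in> fold_strip m"
        using gA y by auto
      then have "\<bar>Im (g (Complex x y)) - Im (g (Complex x y'))\<bar> \<le> 2 * sqrt 2"
        by (auto simp: fold_strip_def abs_le_iff algebra_simps)
      then have "p * \<bar>Im (\<phi> ?u) - Im (\<phi> ?v)\<bar> \<le> 2 * sqrt 2"
        unfolding Img using p by (simp add: right_diff_distrib[symmetric] abs_mult)
      then have "\<bar>Im (\<phi> ?u) - Im (\<phi> ?v)\<bar> \<le> 2 * sqrt 2 / p"
        using p by (simp add: field_simps)
      then have "norm (\<phi> ?u - \<phi> ?v) \<le> 2 * sqrt (2 * sqrt 2 / p)"
        using u by (intro norm_unit_half_circle_diff_le norm_phi Re_phi)
      then have "L * norm (\<phi> ?u - \<phi> ?v) \<le> L * (2 * sqrt (2 * sqrt 2 / p))"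
        using L by (intro mult_left_mono) auto
      moreover have "sqrt (2 * sqrt 2 / p) = sqrt (2 * sqrt 2 / nu) * exp (- lam * x / 2)"
      proof (rule real_sqrt_unique)
        have "(exp (- lam * x / 2))\<^sup>2 = exp (- lam * x)"
          by (simp add: power2_eq_square exp_add[symmetric])
        then show "(sqrt (2 * sqrt 2 / nu) * exp (- lam * x / 2))\<^sup>2 = 2 * sqrt 2 / p"
          using nu by (simp add: power_mult_distrib p_def exp_minus field_simps)
      qed (use nu in auto)
      moreover have "\<bar>y - y'\<bar> \<le> L * norm (\<phi> ?u - \<phi> ?v)"
        using expand[OF u] by (simp add: fold_coord_diff)
      ultimately show ?thesis by (simp add: D_def)
    qed
    then have "emeasure lborel {y. Complex x y \<in> A} \<le> ennreal (?h x)"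
      by (intro emeasure_lborel_le_diam) blast
    then show ?thesis using True by simp
  qed
  have "emeasure lborel A \<le> (\<integral>\<^sup>+x. ennreal (?h x) * indicator {0..} x \<partial>lborel)"
    unfolding emeasure_lborel_complex_slices[OF borel_compact[OF A(1)]]
    by (intro nn_integral_mono slice)
  \<comment> \<open>The antiderivative \<open>- (2 * D / lam) * exp (- lam * x / 2)\<close> tends to
    0 at infinity, so the integral over x \<ge> 0 is \<open>2 * D / lam\<close>.\<close>
  also have "\<dots> = ennreal (0 - (- (2 * D / lam) * exp (- lam * 0 / 2)))"
  proof (rule nn_integral_FTC_atLeast)
    show "((\<lambda>x. - (2 * D / lam) * exp (- lam * x / 2)) has_real_derivative ?h x) (at x)" for x
      using lam by (auto intro!: derivative_eq_intros)
    have "filterlim (\<lambda>x. - lam / 2 * x) at_bot at_top"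
      using lam by (intro filterlim_tendsto_neg_mult_at_bot[OF tendsto_const] filterlim_ident) auto
    then have "((\<lambda>x. exp (- lam / 2 * x)) \<longlongrightarrow> 0) at_top"
      by (rule filterlim_compose[OF exp_at_bot])
    then have "((\<lambda>x. - (2 * D / lam) * exp (- lam / 2 * x)) \<longlongrightarrow> - (2 * D / lam) * 0) at_top"
      by (intro tendsto_intros)
    then show "((\<lambda>x. - (2 * D / lam) * exp (- lam * x / 2)) \<longlongrightarrow> 0) at_top" by simp
  qed (use D in auto)
  finally have "emeasure lborel A \<le> ennreal (2 * D / lam)" by simp
  then have "measure lborel A \<le> 2 * D / lam"
    using D lam by (simp add: measure_def enn2real_leI)
  then show ?thesis by (simp add: D_def mult.assoc)
qed

lemma measure_strip_into_strip_le:
  assumes A: "compact A" "A \<subseteq> fold_strip k" and x0: "\<And>z. z \<in> A \<Longrightarrow> 0 \<le> Re z"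
    and gA: "g ` A \<subseteq> fold_strip m"
  shows "measure lborel A \<le> 2 * (4 * L * sqrt (2 * sqrt 2 / nu) / lam)"
  using x0 gA
  by (intro measure_strip_le_blocks[OF A] measure_block_into_strip_le[of _ _ m]
      compact_Int_closed[OF A(1) closed_fold_block]) auto

section \<open>Geometric growth against bounded area\<close>

lemma iterate_meets_reals:
  assumes big: "nu\<^sup>2 * lam > 2 * L"
    and conn: "connected V" and meas: "V \<in> sets lebesgue" and pos: "emeasure lebesgue V > 0"
  shows "\<exists>n\<ge>1. (g ^^ n) ` V \<inter> \<real> \<noteq> {}"
proof (rule ccontr)
  assume "\<not> ?thesis"
  then have none: "(g ^^ Suc n) ` V \<inter> \<real> = {}" for n
    by (metis One_nat_def Suc_le_eq zero_less_Suc)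
  have Suc_image: "(g ^^ Suc n) ` X = g ` (g ^^ n) ` X" for n X
    by (simp add: image_comp)
  \<comment> \<open>A point of an iterate on one of the lines Im z = 2 sqrt 2 m would be sent to a
    real point of the next iterate.\<close>
  have strip: "\<exists>m. (g ^^ n) ` V \<subseteq> fold_strip m" if "connected ((g ^^ n) ` V)" for n
  proof (rule connected_subset_fold_strip[OF that])
    fix z m assume z: "z \<in> (g ^^ n) ` V"
    then have "g z \<in> (g ^^ Suc n) ` V" by (simp only: Suc_image imageI)
    then show "Im z \<noteq> 2 * sqrt 2 * of_int m" using none[of n] g_real[of z m] by blast
  qed
  \<comment> \<open>Connectedness puts an iterate into a strip, and the continuity of
    \<open>g\<close> on that strip makes the next iterate connected.\<close>
  have conn_n: "connected ((g ^^ n) ` V)" for n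
  proof (induction n)
    case 0
    then show ?case using conn by simp
  next
    case (Suc n)
    then obtain m where "(g ^^ n) ` V \<subseteq> fold_strip m" using strip by blast
    then show ?case
      unfolding Suc_image
      by (intro connected_continuous_image Suc continuous_on_subset[OF continuous_on_g_strip])
  qed
  then have "\<forall>n. \<exists>m. (g ^^ n) ` V \<subseteq> fold_strip m" using strip by blast
  then obtain m where m: "\<And>n. (g ^^ n) ` V \<subseteq> fold_strip (m n)" by metis

  obtain K where K: "compact K" "K \<subseteq> V" "measure lborel K > 0"
    using lebesgue_pos_compact_subset[OF meas pos] .
  define A where "A n = (g ^^ n) ` K" for n
  have A_Suc: "A (Suc n) = g ` A n" for n unfolding A_def by (rule Suc_image)
  have A_strip: "A n \<subseteq> fold_strip (m n)" for n
    using m[of n] K(2) by (auto simp: A_def)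
  have A_compact: "compact (A n)" for n
  proof (induction n)
    case 0
    then show ?case using K by (simp add: A_def)
  next
    case (Suc n)
    then show ?case unfolding A_Suc using A_strip by (rule compact_image_strip)
  qed
  have A_nonneg: "0 \<le> Re z" if "z \<in> A (Suc n)" for z n
    using that Re_g_nonneg by (auto simp: A_Suc)
  \<comment> \<open>The count starts at the first image: \<open>K\<close> may reach into Re z < 0,
    while every image under \<open>g\<close> has Re z \<ge> 0.\<close>
  define \<mu> where "\<mu> n = measure lborel (A (Suc n))" for n
  \<comment> \<open>The reciprocal of the factor in \<open>measure_le_image_strip\<close> at
    \<open>x0 = 0\<close>; \<open>big\<close> says that it exceeds 1.\<close>
  define q where "q = nu\<^sup>2 * lam / (2 * L)"
  define C where "C = 2 * (4 * L * sqrt (2 * sqrt 2 / nu) / lam)"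
  \<comment> \<open>By compactness Re z is bounded below on \<open>K\<close>. The resulting factor
    may be large, but it is finite, so the first image is not null.\<close>
  have "\<mu> 0 > 0"
  proof -
    obtain x0 where x0: "\<And>z. z \<in> K \<Longrightarrow> - x0 \<le> Re z"
      using compact_imp_bounded[OF K(1)] abs_Re_le_cmod unfolding bounded_iff
      by (metis abs_le_iff minus_le_iff order_trans)
    have "measure lborel (A 0) \<le> 2 * (L / (lam * (nu * exp (lam * - x0))\<^sup>2) * measure lborel (g ` A 0))"
      using x0 by (intro measure_le_image_strip[OF A_compact A_strip]) (simp add: A_def)
    then have "0 < L / (lam * (nu * exp (lam * - x0))\<^sup>2) * \<mu> 0"
      using K(3) by (simp add: \<mu>_def A_Suc) (simp add: A_def)
    moreover have "0 < L / (lam * (nu * exp (lam * - x0))\<^sup>2)" using L lam nu by simp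
    ultimately show ?thesis by (rule zero_less_mult_pos)
  qed
  moreover have step: "q * \<mu> n \<le> \<mu> (Suc n)" for n
  proof -
    have "\<mu> n \<le> 2 * (L / (lam * (nu * exp (lam * 0))\<^sup>2) * measure lborel (g ` A (Suc n)))"
      unfolding \<mu>_def by (intro measure_le_image_strip[OF A_compact A_strip] A_nonneg)
    then show ?thesis using L lam nu by (simp add: \<mu>_def A_Suc q_def field_simps)
  qed
  moreover have "q > 1" using big L by (simp add: q_def)
  \<comment> \<open>The bound does not depend on \<open>n\<close>, since each iterate and its image
    lie in strips of the same height.\<close>
  moreover have "\<mu> n \<le> C" for n
    unfolding \<mu>_def C_def
    by (rule measure_strip_into_strip_le[OF A_compact A_strip A_nonneg])
       (use A_strip[of "Suc (Suc n)"] in \<open>simp_all add: A_Suc\<close>)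
  moreover have "q ^ n * \<mu> 0 \<le> \<mu> n" for n
  proof (induction n)
    case (Suc n)
    then have "q * (q ^ n * \<mu> 0) \<le> q * \<mu> n" using \<open>q > 1\<close> by (intro mult_left_mono) auto
    with step[of n] show ?case by (simp add: mult.assoc)
  qed simp
  moreover obtain n where "C / \<mu> 0 < q ^ n" using real_arch_pow[OF \<open>q > 1\<close>] by blast
  ultimately show False by (metis divide_less_eq not_le order_trans)
qed

end

section \<open>The Zorich map on the invariant plane as a folded exponential\<close>

text \<open>On the diagonal the first two components of \<open>h\<close> agree, so the unit norm
  reads 2 h1^2 + h3^2 = 1; hence the factor sqrt 2 in \<open>zb\<close>.\<close>

lemma diag_curve_unit:
  assumes onto: "h ` sqQ = upper_hemisphere" and diag: "\<And>t. t \<in> {-1..1} \<Longrightarrow> hc1 h t t = hc2 h t t"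
    and y: "\<bar>y\<bar> \<le> sqrt 2"
  shows "norm (Complex (za h y) (zb h y)) = 1" "0 \<le> za h y"
proof -
  define t where "t = y / sqrt 2"
  have t: "t \<in> {-1..1}" using y by (auto simp: t_def abs_le_iff field_simps)
  then have "h (t, t) \<in> upper_hemisphere" using onto by (auto simp: sqQ_def)
  then have h: "norm (h (t, t)) = 1" "0 \<le> hc3 h t t" by (auto simp: upper_hemisphere_def hc3_def)
  then show "0 \<le> za h y" by (simp add: za_def t_def)
  have "(norm (h (t, t)))\<^sup>2 = (hc1 h t t)\<^sup>2 + (hc2 h t t)\<^sup>2 + (hc3 h t t)\<^sup>2"
    by (cases "h (t, t)") (simp add: norm_Pair hc1_def hc2_def hc3_def)
  then have "(za h y)\<^sup>2 + (zb h y)\<^sup>2 = 1"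
    using h diag[OF t] by (simp add: za_def zb_def t_def power_mult_distrib)
  then show "norm (Complex (za h y) (zb h y)) = 1" by (simp add: cmod_def)
qed

text \<open>The coordinates (h3, sqrt 2 h1) are isometric on the plane x1 = x2, so the bi-Lipschitz
  constant of \<open>h\<close> passes to the curve unchanged.\<close>

lemma diag_curve_dist:
  assumes diag: "\<And>t. t \<in> {-1..1} \<Longrightarrow> hc1 h t t = hc2 h t t"
    and y: "\<bar>y\<bar> \<le> sqrt 2" "\<bar>y'\<bar> \<le> sqrt 2"
  shows "norm (Complex (za h y) (zb h y) - Complex (za h y') (zb h y'))
    = dist (h (y / sqrt 2, y / sqrt 2)) (h (y' / sqrt 2, y' / sqrt 2))"
proof -
  define s t where "s = y / sqrt 2" and "t = y' / sqrt 2"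
  have st: "s \<in> {-1..1}" "t \<in> {-1..1}" using y by (auto simp: s_def t_def abs_le_iff field_simps)
  have "(dist (h (s, s)) (h (t, t)))\<^sup>2
      = (hc1 h s s - hc1 h t t)\<^sup>2 + (hc2 h s s - hc2 h t t)\<^sup>2 + (hc3 h s s - hc3 h t t)\<^sup>2"
    by (cases "h (s, s)"; cases "h (t, t)")
       (simp add: dist_prod_def dist_real_def hc1_def hc2_def hc3_def)
  also have "\<dots> = (za h y - za h y')\<^sup>2 + (zb h y - zb h y')\<^sup>2"
    using diag[OF st(1)] diag[OF st(2)]
    by (simp add: za_def zb_def s_def t_def power_mult_distrib right_diff_distrib[symmetric])
  also have "\<dots> = (norm (Complex (za h y) (zb h y) - Complex (za h y') (zb h y')))\<^sup>2"
    by (simp add: cmod_power2)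
  finally show ?thesis by (simp add: s_def t_def)
qed

text \<open>The definition chooses one \<open>k\<close> by a floor, whereas closed blocks overlap
  along their edges; the two descriptions have to be matched there as well.\<close>

lemma zorich_g_block:
  assumes z: "z \<in> fold_block j"
  shows "zorich_g h lam nu z = complex_of_real (nu * exp (lam * Re z)) *
    Complex (za h (fold_coord j (Im z))) (zb h (fold_coord j (Im z)))"
proof -
  \<comment> \<open>Heights in units of sqrt 2, so that the lines of reflection become odd
    integers.\<close>
  define q where "q = Im z / sqrt 2"
  define u where "u = (let k = real_of_int \<lfloor>(q + 1) / 4\<rfloor> in
    if q \<le> 4 * k + 1 then sqrt 2 * (q - 4 * k) else sqrt 2 * (2 - q + 4 * k))"
  have Im_z: "Im z = sqrt 2 * q" by (simp add: q_def)
  have le_iff: "Im z \<le> (4 * k + 1) * sqrt 2 \<longleftrightarrow> q \<le> 4 * k + 1" for k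
    by (simp add: Im_z mult.commute)
  have args: "Im z - 4 * k * sqrt 2 = sqrt 2 * (q - 4 * k)"
    "2 * sqrt 2 - Im z - 4 * (- k) * sqrt 2 = sqrt 2 * (2 - q + 4 * k)" for k
    by (simp_all add: Im_z algebra_simps)
  have g_eq: "zorich_g h lam nu z
      = complex_of_real (nu * exp (lam * Re z)) * Complex (za h u) (zb h u)"
    unfolding zorich_g_def Let_def u_def q_def[symmetric] le_iff args by simp
  have fold: "fold_coord j (Im z) = sqrt 2 * (if even j then q - 2 * of_int j else 2 * of_int j - q)"
    by (simp add: fold_coord_def Im_z algebra_simps)
  have "\<bar>sqrt 2 * (q - 2 * of_int j)\<bar> \<le> sqrt 2 * 1"
    using z by (simp add: fold_block_def Im_z algebra_simps)
  then have q: "\<bar>q - 2 * of_int j\<bar> \<le> 1"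
    unfolding abs_mult by simp
  have "u = fold_coord j (Im z)"
  proof (cases "even j")
    case True
    then obtain k where k: "j = 2 * k" by (elim evenE)
    have "\<lfloor>(q + 1) / 4\<rfloor> = k" using q k by (simp add: floor_eq_iff abs_le_iff)
    then show ?thesis using q k unfolding u_def fold by (simp add: abs_le_iff)
  next
    case False
    then obtain k where k: "j = 2 * k + 1" by (elim oddE)
    \<comment> \<open>At the lower edge the unreflected clause still applies, with folded value sqrt
      2. At the upper edge the floor has already jumped to \<open>k + 1\<close>, and the unreflected
      clause gives - sqrt 2, the same as the reflection.\<close>
    consider "q = 4 * k + 1" | "4 * k + 1 < q" "q < 4 * k + 3" | "q = 4 * k + 3"
      using q k by (force simp: abs_le_iff)
    then show ?thesis
    proof cases
      case 1
      then have "\<lfloor>(q + 1) / 4\<rfloor> = k" by (simp add: floor_eq_iff)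
      then show ?thesis using 1 k unfolding u_def fold by simp
    next
      case 2
      then have "\<lfloor>(q + 1) / 4\<rfloor> = k" by (simp add: floor_eq_iff)
      then show ?thesis using 2 k unfolding u_def fold by simp
    next
      case 3
      then have "\<lfloor>(q + 1) / 4\<rfloor> = k + 1" by (simp add: floor_eq_iff)
      then show ?thesis using 3 k unfolding u_def fold by simp
    qed
  qed
  with g_eq show ?thesis by simp
qed

theorem theorem3p1:
  fixes h :: "real \<times> real \<Rightarrow> real \<times> real \<times> real"
    and L lam nu :: real
    and V :: "complex set"
  assumes L: "L \<ge> 1"
    and bilip: "bi_lipschitz_on L sqQ h"
    and onto: "h ` sqQ = upper_hemisphere"
    and bdry: "h ` frontier sqQ = equator"
    and sense: "sense_preserving_hemi h"
    and diag: "\<And>t. t \<in> {-1..1} \<Longrightarrow> hc1 h t t = hc2 h t t"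
    and antidiag: "\<And>t. t \<in> {-1..1} \<Longrightarrow> hc1 h t (-t) = - hc2 h t (-t)"
    and lam: "lam \<ge> 1"
    and nu: "nu > 0"
    and big: "nu\<^sup>2 * lam > 2 * L"
    and conn: "connected V"
    and meas: "V \<in> sets lebesgue"
    and pos: "emeasure lebesgue V > 0"
  shows "\<exists>n::nat. n \<ge> 1 \<and> (zorich_g h lam nu ^^ n) ` V \<inter> \<real> \<noteq> {}"
proof -
  let ?c = "\<lambda>y. Complex (za h y) (zb h y)"
  \<comment> \<open>Division by sqrt 2 parametrises the diagonal of the square by arc
    length.\<close>
  have dist_diag: "dist (y / sqrt 2, y / sqrt 2) (y' / sqrt 2, y' / sqrt 2) = \<bar>y - y'\<bar>" for y y'
  proof -
    have "(y / sqrt 2 - y' / sqrt 2)\<^sup>2 + (y / sqrt 2 - y' / sqrt 2)\<^sup>2 = (y - y')\<^sup>2"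
      unfolding diff_divide_distrib[symmetric] power_divide by simp
    then show ?thesis
      by (simp only: dist_Pair_Pair dist_real_def power2_abs real_sqrt_abs)
  qed
  have in_Q: "(y / sqrt 2, y / sqrt 2) \<in> sqQ" if "\<bar>y\<bar> \<le> sqrt 2" for y
    using that by (auto simp: sqQ_def abs_le_iff field_simps)
  have lip: "\<bar>y - y'\<bar> / L \<le> norm (?c y - ?c y')" "norm (?c y - ?c y') \<le> L * \<bar>y - y'\<bar>"
    if "\<bar>y\<bar> \<le> sqrt 2" "\<bar>y'\<bar> \<le> sqrt 2" for y y'
  proof -
    have "norm (?c y - ?c y') = dist (h (y / sqrt 2, y / sqrt 2)) (h (y' / sqrt 2, y' / sqrt 2))"
      using diag that by (rule diag_curve_dist)
    then show "\<bar>y - y'\<bar> / L \<le> norm (?c y - ?c y')" "norm (?c y - ?c y') \<le> L * \<bar>y - y'\<bar>"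
      using bilip in_Q[OF that(1)] in_Q[OF that(2)]
      unfolding bi_lipschitz_on_def by (metis dist_diag)+
  qed
  interpret folded_exponential ?c L lam nu "zorich_g h lam nu"
  proof
    show "L > 0" "lam > 0" "nu > 0" using L lam nu by auto
    show "norm (?c y) = 1" "0 \<le> Re (?c y)" if "\<bar>y\<bar> \<le> sqrt 2" for y
      using diag_curve_unit[OF onto diag that] by auto
    \<comment> \<open>The two diagonals cross at the centre, where h1 = h2 and h1 = -h2 force h1 =
      0.\<close>
    show "Im (?c 0) = 0" using diag[of 0] antidiag[of 0] by (simp add: zb_def)
    show "\<bar>y - y'\<bar> \<le> L * norm (?c y - ?c y')" if "\<bar>y\<bar> \<le> sqrt 2" "\<bar>y'\<bar> \<le> sqrt 2" for y y'
      using lip(1)[OF that] L by (simp add: field_simps)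
    show "continuous_on {- sqrt 2..sqrt 2} ?c"
      by (rule lipschitz_on_continuous_on[of L])
         (use lip(2) L in \<open>auto intro!: lipschitz_onI simp: dist_norm abs_le_iff\<close>)
  qed (rule zorich_g_block)
  show ?thesis using iterate_meets_reals[OF big conn meas pos] .
qed

end
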